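(* For every positive integer $h$, the vertex-forwarding index of the multiplicative circulant graph $\Gamma_{3^h}=MC(3^h)$ is $$\xi(\Gamma_{3^h})=3^{h-1}(2h-3)+1.$$
   Context: For integers $m>1$, $h>0$, $MC(m^h)$ is the graph with vertex set $\mathbb{Z}_{m^h}$ in which distinct vertices $x,y$ are adjacent iff $x-y\equiv \pm m^i \pmod{m^h}$ for some $i\in\{0,\ldots,h-1\}$. For a connected graph $\Gamma$ on $N$ vertices, a routing $R$ is a choice of one path $R(x,y)$ from $x$ to $y$ for each of the $N(N-1)$ ordered pairs $(x,y)$ of distinct vertices. The load $\xi_x(\Gamma,R)$ of a vertex $x$ is the number of paths of $R$ having $x$ as an inner (non-end) vertex; $\xi(\Gamma,R)=\max_x \xi_x(\Gamma,R)$; and the vertex-forwarding index is $\xi(\Gamma)=\min_R \xi(\Gamma,R)$ over all routings $R$ of $\Gamma$. *)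

theory Defs
  imports "HOL-Number_Theory.Cong" "Graph_Theory.Graph_Theory"
begin

text \<open>
  Simple graphs are symmetric loop-free \<^typ>\<open>'a pair_pre_digraph\<close>s (locale \<^locale>\<open>pair_graph\<close>):
  an undirected edge is a pair of opposite arcs. The vertex set \<open>\<int>/m\<^sup>h\<close> is represented by the
  residues \<open>0, \<dots>, m\<^sup>h - 1\<close>.
\<close>

definition mult_circulant :: "nat \<Rightarrow> nat \<Rightarrow> int pair_pre_digraph" where
  "mult_circulant m h =
     \<lparr> pverts = {0..<int m ^ h},
       parcs = {(x, y). x \<in> {0..<int m ^ h} \<and> y \<in> {0..<int m ^ h} \<and> x \<noteq> y \<and>
         (\<exists>i<h. [x - y = int m ^ i] (mod int m ^ h) \<or> [x - y = - (int m ^ i)] (mod int m ^ h))} \<rparr>"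

text \<open>
  Paths are vertex lists without repetitions. The values of a routing outside the ordered pairs of
  distinct vertices are irrelevant.
\<close>

definition is_routing :: "'a pair_pre_digraph \<Rightarrow> ('a \<Rightarrow> 'a \<Rightarrow> 'a list) \<Rightarrow> bool" where
  "is_routing G R \<longleftrightarrow>
     (\<forall>u \<in> pverts G. \<forall>v \<in> pverts G. u \<noteq> v \<longrightarrow>
        vpath (R u v) (with_proj G) \<and> hd (R u v) = u \<and> last (R u v) = v)"

definition vertex_load :: "'a pair_pre_digraph \<Rightarrow> ('a \<Rightarrow> 'a \<Rightarrow> 'a list) \<Rightarrow> 'a \<Rightarrow> nat" where
  "vertex_load G R x =
     card {(u, v). u \<in> pverts G \<and> v \<in> pverts G \<and> u \<noteq> v \<and> x \<in> set (R u v) - {u, v}}"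

definition routing_load :: "'a pair_pre_digraph \<Rightarrow> ('a \<Rightarrow> 'a \<Rightarrow> 'a list) \<Rightarrow> nat" where
  "routing_load G R = Max (vertex_load G R ` pverts G)"

text \<open>
  The infimum of a nonempty set of natural numbers is its minimum; the set is nonempty for every
  connected graph. For multiplicative circulant graphs this is
  \<open>vertex_forwarding_index_attained\<close> below.
\<close>

definition vertex_forwarding_index :: "'a pair_pre_digraph \<Rightarrow> nat" where
  "vertex_forwarding_index G = Inf (routing_load G ` {R. is_routing G R})"

lemma pair_graph_mult_circulant: "pair_graph (mult_circulant m h)"
proof
  have "parcs (mult_circulant m h) \<subseteq> {0..<int m ^ h} \<times> {0..<int m ^ h}"
    by (auto simp: mult_circulant_def)
  then show "finite (parcs (mult_circulant m h))"
    by (rule finite_subset) simp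
  have "[y - x = c] (mod n) \<longleftrightarrow> [x - y = - c] (mod n)" for x y c n :: int
    by (metis cong_minus_minus_iff minus_diff_eq)
  then show "symmetric (with_proj (mult_circulant m h))"
    unfolding symmetric_def by (auto simp: mult_circulant_def sym_def)
qed (auto simp: mult_circulant_def)

lemma mult_circulant_reachable_0:
  assumes "m > 1" "h > 0" "int k < int m ^ h"
  shows "0 \<rightarrow>\<^sup>*\<^bsub>with_proj (mult_circulant m h)\<^esub> int k"
proof -
  interpret pair_graph "mult_circulant m h" by (rule pair_graph_mult_circulant)
  show ?thesis using assms(3)
  proof (induction k)
    case 0
    then have "0 \<in> pverts (mult_circulant m h)" by (simp add: mult_circulant_def)
    then show ?case by simp
  next
    case (Suc k)
    have "int k < int m ^ h" using Suc.prems by linarith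
    then have "(int k, int (Suc k)) \<in> parcs (mult_circulant m h)"
      using Suc.prems assms(1,2) by (auto simp: mult_circulant_def intro!: exI[of _ 0])
    then have "int k \<rightarrow>\<^sup>*\<^bsub>with_proj (mult_circulant m h)\<^esub> int (Suc k)"
      by (intro reachable_adjI) simp
    with Suc.IH[OF \<open>int k < int m ^ h\<close>] show ?case by (rule reachable_trans)
  qed
qed

lemma mult_circulant_routing_exists:
  assumes "m > 1" "h > 0"
  shows "\<exists>R. is_routing (mult_circulant m h) R"
proof -
  interpret pair_graph "mult_circulant m h" by (rule pair_graph_mult_circulant)
  let ?G = "with_proj (mult_circulant m h)"
  have "\<exists>p. vpath p ?G \<and> hd p = u \<and> last p = v"
    if "u \<in> pverts (mult_circulant m h)" "v \<in> pverts (mult_circulant m h)" for u v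
  proof -
    have r: "0 \<rightarrow>\<^sup>*\<^bsub>?G\<^esub> w" if "w \<in> pverts (mult_circulant m h)" for w
      using mult_circulant_reachable_0[OF assms, of "nat w"] that
      by (simp add: mult_circulant_def)
    have "u \<rightarrow>\<^sup>*\<^bsub>?G\<^esub> v"
      using symmetric_reachable[OF pair_sym_arcs r[OF that(1)]] r[OF that(2)]
      by (rule reachable_trans)
    then obtain p where "vwalk p ?G" "hd p = u" "last p = v"
      using reachable_vwalk_conv by blast
    then show ?thesis by (rule vwalk_imp_ex_vpath)
  qed
  then show ?thesis unfolding is_routing_def by metis
qed

lemma vertex_forwarding_index_attained:
  assumes "m > 1" "h > 0"
  shows "\<exists>R. is_routing (mult_circulant m h) R \<and>
    routing_load (mult_circulant m h) R = vertex_forwarding_index (mult_circulant m h) \<and>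
    (\<forall>R'. is_routing (mult_circulant m h) R' \<longrightarrow>
      routing_load (mult_circulant m h) R \<le> routing_load (mult_circulant m h) R')"
proof -
  let ?L = "routing_load (mult_circulant m h) ` {R. is_routing (mult_circulant m h) R}"
  have "Inf ?L \<in> ?L"
    using mult_circulant_routing_exists[OF assms] by (intro Inf_nat_def1) auto
  then obtain R where R: "is_routing (mult_circulant m h) R"
      "Inf ?L = routing_load (mult_circulant m h) R" by auto
  moreover have "Inf ?L \<le> routing_load (mult_circulant m h) R'"
    if "is_routing (mult_circulant m h) R'" for R'
    using that by (intro cInf_lower) auto
  ultimately show ?thesis unfolding vertex_forwarding_index_def by auto
qed

end

theory Submission
  imports Defs
begin

text \<open>
  Every residue modulo \<open>3\<^sup>h\<close> has a unique balanced ternary expansion with \<open>h\<close> digits in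
  \<open>{-1, 0, 1}\<close>. Adding \<open>\<plusminus>3\<^sup>i\<close> raises the number of nonzero digits by at most one, because a
  carry arises only at a nonzero digit, which stays nonzero, and goes on to the next digit;
  hence the distance of two vertices is the number of nonzero digits of their difference.
  Averaging the loads over all vertices bounds the forwarding index from below by the sum of
  \<open>d(0, x) - 1\<close> over \<open>x \<noteq> 0\<close>, and the translates of a fixed family of shortest
  paths from \<open>0\<close> form a routing in which every vertex has exactly this load. The nonzero digits
  of all residues number \<open>2h3\<^sup>h\<^sup>-\<^sup>1\<close>.
\<close>

section \<open>Balanced ternary weight\<close>

text \<open>The lowest balanced ternary digit of \<open>x\<close> is \<open>x - 3 * ((x + 1) div 3)\<close>.\<close>

primrec bt_weight :: "nat \<Rightarrow> int \<Rightarrow> nat" where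
  "bt_weight 0 x = 0"
| "bt_weight (Suc h) x = (if 3 dvd x then 0 else 1) + bt_weight h ((x + 1) div 3)"

text \<open>Recursion by the lowest digit 0, 1 or -1; most digit computations below rewrite with
  these equations instead of \<open>bt_weight.simps\<close>.\<close>

lemma bt_weight_triple:
  "bt_weight (Suc h) (3 * q) = bt_weight h q"
  "bt_weight (Suc h) (3 * q + 1) = Suc (bt_weight h q)"
  "bt_weight (Suc h) (3 * q - 1) = Suc (bt_weight h q)"
proof -
  have "(3 * q + 1) div 3 = q" "(3 * q + 2) div 3 = q"
    "\<not> 3 dvd 3 * q + 1" "\<not> 3 dvd 3 * q - 1"
    by presburger+
  then show "bt_weight (Suc h) (3 * q) = bt_weight h q"
    "bt_weight (Suc h) (3 * q + 1) = Suc (bt_weight h q)"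
    "bt_weight (Suc h) (3 * q - 1) = Suc (bt_weight h q)"
    by (simp_all add: add.assoc)
qed

lemma int_balanced_mod3_cases:
  fixes x :: int
  obtains (zero) q where "x = 3 * q" | (pos) q where "x = 3 * q + 1" | (neg) q where "x = 3 * q - 1"
proof -
  have "x = 3 * (x div 3) \<or> x = 3 * (x div 3) + 1 \<or> x = 3 * (x div 3 + 1) - 1"
    by presburger
  then show ?thesis
    using that by blast
qed

text \<open>Only the lowest \<open>h\<close> digits are counted, so the weight depends on the
  residue alone. This makes it usable for differences of vertices.\<close>

lemma bt_weight_add_multiple: "bt_weight h (x + 3 ^ h * k) = bt_weight h x"
proof (induction h arbitrary: x)
  case (Suc h)
  have "x + 3 ^ Suc h * k + 1 = (x + 1) + 3 * (3 ^ h * k)"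
    by (simp add: algebra_simps)
  then have "(x + 3 ^ Suc h * k + 1) div 3 = (x + 1) div 3 + 3 ^ h * k"
    by simp
  moreover have "3 dvd x + 3 ^ Suc h * k \<longleftrightarrow> 3 dvd x"
    by (simp add: mult.assoc dvd_add_left_iff)
  ultimately show ?case
    using Suc.IH by simp
qed simp

lemma bt_weight_cong: "[x = y] (mod 3 ^ h) \<Longrightarrow> bt_weight h x = bt_weight h y"
  by (metis bt_weight_add_multiple cong_iff_lin)

lemma bt_weight_zero [simp]: "bt_weight h 0 = 0"
  by (induction h) auto

text \<open>The exponent \<open>i\<close> ranges over all naturals because a carry out of the top
  digit meets the induction hypothesis at \<open>h = 0\<close>, \<open>i = 0\<close>.\<close>

lemma bt_weight_add_power_le:
  assumes "s \<in> {1, -1}"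
  shows "bt_weight h (x + s * 3 ^ i) \<le> Suc (bt_weight h x)"
  using assms
proof (induction h arbitrary: x i s)
  case (Suc h)
  show ?case
  proof (cases i)
    case 0
    have up: "bt_weight h (q + 1) \<le> Suc (bt_weight h q)" for q
      using Suc.IH[of 1 q 0] by simp
    have down: "bt_weight h (q - 1) \<le> Suc (bt_weight h q)" for q
      using Suc.IH[of "-1" q 0] by simp
    show ?thesis
    proof (cases x rule: int_balanced_mod3_cases)
      case (zero q)
      then show ?thesis
        using 0 Suc.prems by (auto simp: bt_weight_triple simp del: bt_weight.simps)
    next
      case (pos q)
      \<comment> \<open>Since 1 + 1 = 3 - 1, the digit 1 turns into -1 and 1 is carried to
        \<open>q\<close>. The digit still counts once, so any growth comes from the carry, which
        \<open>up\<close> bounds.\<close>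
      have "x + 1 = 3 * (q + 1) - 1" "x + - 1 = 3 * q"
        using pos by auto
      then have "bt_weight (Suc h) (x + 1) = Suc (bt_weight h (q + 1))"
          "bt_weight (Suc h) (x + - 1) = bt_weight h q"
        by (metis bt_weight_triple)+
      then show ?thesis
        using 0 Suc.prems up[of q] pos by (auto simp: bt_weight_triple simp del: bt_weight.simps)
    next
      case (neg q)
      have "x + - 1 = 3 * (q - 1) + 1" "x + 1 = 3 * q"
        using neg by auto
      then have "bt_weight (Suc h) (x + - 1) = Suc (bt_weight h (q - 1))"
          "bt_weight (Suc h) (x + 1) = bt_weight h q"
        by (metis bt_weight_triple)+
      then show ?thesis
        using 0 Suc.prems down[of q] neg by (auto simp: bt_weight_triple simp del: bt_weight.simps)
    qed
  next
    case (Suc j)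
    have eq: "x + s * 3 ^ i + 1 = (x + 1) + 3 * (s * 3 ^ j)"
      using Suc by (simp add: algebra_simps)
    have "(x + s * 3 ^ i + 1) div 3 = (x + 1) div 3 + s * 3 ^ j"
      unfolding eq
      by simp
    moreover have "3 dvd x + s * 3 ^ i \<longleftrightarrow> 3 dvd x"
      using Suc by (simp add: dvd_add_left_iff)
    ultimately show ?thesis
      using Suc.IH[OF Suc.prems, of "(x + 1) div 3" j] by simp
  qed
qed simp

text \<open>Some digit among the lowest \<open>h\<close> is nonzero. Subtracting the lowest such
  digit \<open>s\<close> at its place \<open>i\<close> clears it without a carry.\<close>

lemma bt_weight_descent:
  assumes "\<not> 3 ^ h dvd x"
  shows "\<exists>i<h. \<exists>s\<in>{1, -1}. bt_weight h x = Suc (bt_weight h (x - s * 3 ^ i))"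
  using assms
proof (induction h arbitrary: x)
  case (Suc h)
  show ?case
  proof (cases x rule: int_balanced_mod3_cases)
    case (zero q)
    with Suc.prems have "\<not> 3 ^ h dvd q"
      by simp
    then obtain i s where i: "i < h" "s \<in> {1, -1}" "bt_weight h q = Suc (bt_weight h (q - s * 3 ^ i))"
      using Suc.IH by blast
    have "x - s * 3 ^ Suc i = 3 * (q - s * 3 ^ i)"
      using zero by (simp add: algebra_simps)
    then have "bt_weight (Suc h) x = Suc (bt_weight (Suc h) (x - s * 3 ^ Suc i))"
      using i(3) zero by (metis bt_weight_triple(1))
    then show ?thesis
      using i(1,2) by (meson Suc_less_eq)
  next
    case (pos q)
    then have "bt_weight (Suc h) x = Suc (bt_weight (Suc h) (x - 1 * 3 ^ 0))"
      by (simp add: bt_weight_triple del: bt_weight.simps)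
    then show ?thesis
      by blast
  next
    case (neg q)
    then have "bt_weight (Suc h) x = Suc (bt_weight (Suc h) (x - (- 1) * 3 ^ 0))"
      by (simp add: bt_weight_triple del: bt_weight.simps)
    then show ?thesis
      by blast
  qed
qed simp

section \<open>Total weight of all residues\<close>

lemma sum_lessThan_triple:
  fixes f :: "nat \<Rightarrow> 'a :: comm_monoid_add"
  shows "(\<Sum>k<3 * n. f k) = (\<Sum>k<n. f (3 * k) + f (3 * k + 1) + f (3 * k + 2))"
proof (induction n)
  case (Suc n)
  have eq: "3 * Suc n = Suc (Suc (Suc (3 * n)))"
    by simp
  show ?case
    unfolding eq sum.lessThan_Suc Suc.IH by (simp add: add.assoc)
qed simp

text \<open>Splitting by the lowest digit, with 3k + 2 = 3(k + 1) - 1, gives S(h+1) = 3 S(h) + 2 *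
  3^h. The factor 3 on the left keeps \<open>h - 1\<close> out of the exponent.\<close>

lemma sum_bt_weight: "3 * (\<Sum>k<3 ^ h. bt_weight h (int k)) = 2 * h * 3 ^ h"
proof (induction h)
  case (Suc h)
  let ?w = "\<lambda>k. bt_weight h (int k)"
  have "(\<Sum>k<3 ^ Suc h. bt_weight (Suc h) (int k))
      = (\<Sum>k<3 ^ h. 2 * ?w k + 2 + ?w (Suc k))"
  proof -
    have "bt_weight (Suc h) (int (3 * k)) = ?w k"
      "bt_weight (Suc h) (int (3 * k + 1)) = Suc (?w k)"
      "bt_weight (Suc h) (int (3 * k + 2)) = Suc (?w (Suc k))" for k
      using bt_weight_triple(1)[of h "int k"] bt_weight_triple(2)[of h "int k"]
        bt_weight_triple(3)[of h "int (Suc k)"]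
      by (simp_all add: algebra_simps del: bt_weight.simps)
    then show ?thesis
      unfolding power_Suc sum_lessThan_triple by (simp add: mult_2 del: bt_weight.simps)
  qed
  also have "\<dots> = 2 * (\<Sum>k<3 ^ h. ?w k) + 2 * 3 ^ h + (\<Sum>k<3 ^ h. ?w (Suc k))"
    unfolding sum.distrib sum_distrib_left by simp
  also have "(\<Sum>k<3 ^ h. ?w (Suc k)) = (\<Sum>k<3 ^ h. ?w k)"
  proof -
    \<comment> \<open>The shifted sum trades the term at 0 for the one at \<open>3 ^ h\<close>, and
      these agree by periodicity.\<close>
    have "?w (3 ^ h) = ?w 0"
      using bt_weight_add_multiple[of h 0 1] by simp
    then show ?thesis
      using sum.lessThan_Suc_shift[of ?w "3 ^ h"] sum.lessThan_Suc[of ?w "3 ^ h"] by simp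
  qed
  finally show ?case
    using Suc by (simp add: algebra_simps del: bt_weight.simps)
qed simp

lemma sum_bt_weight_minus_one:
  assumes "h > 0"
  shows "int (\<Sum>x\<in>{0<..<3 ^ h}. bt_weight h x - 1) = 3 ^ (h - 1) * (2 * int h - 3) + 1"
proof -
  \<comment> \<open>Positive weights make the truncated subtraction of 1 a genuine one.\<close>
  have pos: "bt_weight h x \<ge> 1" if "x \<in> {0<..<3 ^ h}" for x
  proof -
    have "\<not> 3 ^ h dvd x"
      using that zdvd_not_zless by auto
    then show ?thesis
      using bt_weight_descent by fastforce
  qed
  have ins: "{0..<3 ^ h} = insert 0 {0<..<3 ^ h :: int}"
    by auto
  have "int (\<Sum>x\<in>{0<..<3 ^ h}. bt_weight h x - 1) = (\<Sum>x\<in>{0<..<3 ^ h}. int (bt_weight h x) - 1)"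
    using pos by (simp add: of_nat_diff)
  also have "\<dots> = (\<Sum>x\<in>{0<..<3 ^ h}. int (bt_weight h x)) - (3 ^ h - 1)"
    by (simp add: sum_subtractf)
  also have "(\<Sum>x\<in>{0<..<3 ^ h}. int (bt_weight h x)) = (\<Sum>x\<in>{0..<3 ^ h}. int (bt_weight h x))"
    unfolding ins by (subst sum.insert) auto
  also have "\<dots> = (\<Sum>k<3 ^ h. int (bt_weight h (int k)))"
    by (rule sum.reindex_bij_witness[of _ int nat]) (auto simp: nat_less_iff)
  finally show ?thesis
    using arg_cong[OF sum_bt_weight[of h], of int] assms by (cases h) (auto simp: algebra_simps)
qed

section \<open>Distances and shortest paths from 0\<close>

lemma parcs_mult_circulant_iff:
  "(x, y) \<in> parcs (mult_circulant m h) \<longleftrightarrow>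
    x \<in> {0..<int m ^ h} \<and> y \<in> {0..<int m ^ h} \<and> x \<noteq> y \<and>
    (\<exists>i<h. \<exists>s\<in>{1, -1}. [y = x + s * int m ^ i] (mod int m ^ h))"
proof -
  have "[x - y = c] (mod n) \<longleftrightarrow> [y = x - c] (mod n)" for x y c n :: int
    by (simp add: cong_iff_dvd_diff) (metis (no_types) diff_diff_eq diff_right_commute dvd_diff_commute
        add.commute diff_diff_eq2)
  then show ?thesis
    by (auto simp: mult_circulant_def)
qed

lemma pverts_mult_circulant [simp]: "pverts (mult_circulant m h) = {0..<int m ^ h}"
  by (simp add: mult_circulant_def)

text \<open>Each arc adds some \<plusminus>3^i to the displacement and so raises its weight by at
  most one. The inequality is strict because \<open>length p\<close> counts vertices, one more than
  arcs.\<close>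

lemma bt_weight_le_vwalk:
  assumes "vwalk p (with_proj (mult_circulant 3 h))"
  shows "bt_weight h (last p - hd p) < length p"
  using assms
proof (induction p rule: vwalk_induct)
  case (Cons u v p)
  from Cons.hyps have "(u, v) \<in> parcs (mult_circulant 3 h)"
    by simp
  then obtain i s where s: "s \<in> {1, -1}" "[v = u + s * int 3 ^ i] (mod int 3 ^ h)"
    unfolding parcs_mult_circulant_iff by blast
  let ?z = "last (v # p)"
  have "[?z - v + v = ?z - v + (u + s * 3 ^ i)] (mod 3 ^ h)"
    using s(2) by (intro cong_add cong_refl) simp
  then have "[?z - u = ?z - v + s * 3 ^ i] (mod 3 ^ h)"
    by (simp add: cong_iff_dvd_diff algebra_simps)
  then have "bt_weight h (?z - u) = bt_weight h (?z - v + s * 3 ^ i)"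
    by (rule bt_weight_cong)
  also have "\<dots> \<le> Suc (bt_weight h (?z - v))"
    using s(1) by (rule bt_weight_add_power_le)
  finally show ?case
    using Cons.IH by simp
qed simp

text \<open>Clearing one digit of \<open>x\<close> gives the predecessor on the path. The weight
  bound on all vertices of the path keeps the induction going: the new endpoint is heavier than
  every earlier vertex, hence not a repetition.\<close>

lemma ex_vpath_bt_weight:
  assumes "x \<in> {0..<3 ^ h}"
  shows "\<exists>p. vpath p (with_proj (mult_circulant 3 h)) \<and> hd p = 0 \<and> last p = x \<and>
    length p = Suc (bt_weight h x) \<and> (\<forall>y\<in>set p. bt_weight h y \<le> bt_weight h x)"
  using assms
proof (induction "bt_weight h x" arbitrary: x rule: less_induct)
  case less
  show ?case
  proof (cases "x = 0")
    case True
    then show ?thesis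
      by (intro exI[of _ "[0]"]) (auto simp: vpath_def vwalk_def)
  next
    case False
    then have "\<not> 3 ^ h dvd x"
      using less.prems zdvd_not_zless[of x "3 ^ h"] by auto
    then obtain i s where i: "i < h" "s \<in> {1, -1}"
      and w: "bt_weight h x = Suc (bt_weight h (x - s * 3 ^ i))"
      using bt_weight_descent by blast
    define y where "y = (x - s * 3 ^ i) mod 3 ^ h"
    have yx: "[y = x - s * 3 ^ i] (mod 3 ^ h)"
      by (simp add: y_def)
    have wy: "bt_weight h x = Suc (bt_weight h y)"
      using w bt_weight_cong[OF yx] by simp
    have y: "y \<in> {0..<3 ^ h}"
      by (simp add: y_def)
    have "[x = y + s * 3 ^ i] (mod 3 ^ h)"
      using cong_sym[OF cong_add[OF yx cong_refl[of "s * 3 ^ i"]]] by simp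
    then have arc: "(y, x) \<in> parcs (mult_circulant 3 h)"
      using i y less.prems wy by (auto simp: parcs_mult_circulant_iff)
    obtain p where p: "vpath p (with_proj (mult_circulant 3 h))" "hd p = 0" "last p = y"
      "length p = Suc (bt_weight h y)" "\<forall>z\<in>set p. bt_weight h z \<le> bt_weight h y"
      using less.hyps[of y] wy y by auto
    have "p \<noteq> []" "x \<notin> set p"
      using p(4,5) wy by auto
    then have "vpath (p @ [x]) (with_proj (mult_circulant 3 h))"
      using p(1,3) arc less.prems
      by (auto simp: vpath_def vwalk_def vwalk_arcs_append)
    then show ?thesis
      using p \<open>p \<noteq> []\<close> wy by (intro exI[of _ "p @ [x]"]) (auto simp: le_SucI)
  qed
qed

section \<open>Translations as automorphisms\<close>

lemma vwalk_arcs_map: "vwalk_arcs (map f p) = map (map_prod f f) (vwalk_arcs p)"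
  by (induction p rule: vwalk_arcs.induct) auto

lemma translation_mod_eq_iff:
  fixes n :: int
  assumes "x \<in> {0..<n}" "y \<in> {0..<n}"
  shows "(u + x) mod n = (u + y) mod n \<longleftrightarrow> x = y"
  unfolding cong_def[symmetric] cong_add_lcancel using assms by (simp add: cong_def)

text \<open>Adjacency depends only on the difference, so translations preserve arcs; their
  injectivity on residues keeps the vertices distinct.\<close>

lemma vpath_mult_circulant_translate:
  assumes "vpath p (with_proj (mult_circulant m h))" "m > 0"
  shows "vpath (map (\<lambda>x. (u + x) mod int m ^ h) p) (with_proj (mult_circulant m h))"
proof -
  let ?t = "\<lambda>x. (u + x) mod int m ^ h"
  have "(?t x, ?t y) \<in> parcs (mult_circulant m h)" if xy: "(x, y) \<in> parcs (mult_circulant m h)" for x y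
  proof -
    obtain i s where x: "x \<in> {0..<int m ^ h}" "y \<in> {0..<int m ^ h}" "x \<noteq> y"
      and i: "i < h" "s \<in> {1, -1}" "[y = x + s * int m ^ i] (mod int m ^ h)"
      using xy unfolding parcs_mult_circulant_iff by blast
    have "[u + y = u + (x + s * int m ^ i)] (mod int m ^ h)"
      by (intro cong_add cong_refl i(3))
    then have "[?t y = ?t x + s * int m ^ i] (mod int m ^ h)"
      by (simp add: cong_def mod_simps add.assoc)
    moreover have "?t x \<noteq> ?t y"
      using translation_mod_eq_iff x by blast
    ultimately show ?thesis
      using i(1,2) assms(2) by (auto simp: parcs_mult_circulant_iff)
  qed
  moreover have "inj_on ?t {0..<int m ^ h}"
    using translation_mod_eq_iff by (auto simp: inj_on_def)
  ultimately show ?thesis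
    using assms by (auto simp: vpath_def vwalk_def vwalk_arcs_map distinct_map inj_on_subset)
qed

section \<open>Total load and the lower bound\<close>

lemma card_inner_vpath:
  assumes "distinct p" "p \<noteq> []" "hd p = u" "last p = v" "u \<noteq> v"
  shows "card (set p - {u, v}) = length p - 2"
proof -
  have "{u, v} \<subseteq> set p"
    using assms by auto
  then show ?thesis
    using assms by (subst card_Diff_subset) (auto simp: distinct_card)
qed

text \<open>Double counting of the incidences between routes and their inner vertices.\<close>

lemma sum_vertex_load:
  assumes "finite (pverts G)" "is_routing G R"
  shows "(\<Sum>x\<in>pverts G. vertex_load G R x)
    = (\<Sum>u\<in>pverts G. \<Sum>v\<in>pverts G - {u}. length (R u v) - 2)"
proof -
  let ?V = "pverts G"
  let ?P = "Sigma ?V (\<lambda>u. ?V - {u})"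
  have fin: "finite ?P"
    using assms(1) by auto
  have load: "vertex_load G R x = (\<Sum>(u, v)\<in>?P. if x \<in> set (R u v) - {u, v} then 1 else 0)" for x
  proof -
    have "{(u, v). u \<in> ?V \<and> v \<in> ?V \<and> u \<noteq> v \<and> x \<in> set (R u v) - {u, v}}
        = {e \<in> ?P. case e of (u, v) \<Rightarrow> x \<in> set (R u v) - {u, v}}"
      by auto
    then show ?thesis
      using fin by (auto simp: vertex_load_def sum.If_cases Int_def case_prod_unfold)
  qed
  have "(\<Sum>x\<in>?V. vertex_load G R x)
      = (\<Sum>(u, v)\<in>?P. \<Sum>x\<in>?V. if x \<in> set (R u v) - {u, v} then 1 else 0)"
    unfolding load by (subst sum.swap) (simp add: case_prod_unfold)
  also have "\<dots> = (\<Sum>(u, v)\<in>?P. length (R u v) - 2)"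
  proof (intro sum.cong refl)
    fix e assume "e \<in> ?P"
    then obtain u v where e: "e = (u, v)" and uv: "u \<in> ?V" "v \<in> ?V" "u \<noteq> v"
      by blast
    then have p: "vpath (R u v) (with_proj G)" "hd (R u v) = u" "last (R u v) = v"
      using assms(2) by (auto simp: is_routing_def)
    then have "?V \<inter> {x. x \<in> set (R u v) - {u, v}} = set (R u v) - {u, v}"
      by (auto simp: vpath_def vwalk_def)
    then show "(case e of (u, v) \<Rightarrow> \<Sum>x\<in>?V. if x \<in> set (R u v) - {u, v} then 1 else 0)
        = (case e of (u, v) \<Rightarrow> length (R u v) - 2)"
      using p uv assms(1) by (simp add: e sum.If_cases card_inner_vpath vpath_def vwalk_def)
  qed
  also have "\<dots> = (\<Sum>u\<in>?V. \<Sum>v\<in>?V - {u}. length (R u v) - 2)"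
    using assms(1) by (subst sum.Sigma) auto
  finally show ?thesis .
qed

lemma routing_load_lower_bound:
  assumes "is_routing (mult_circulant 3 h) R"
  shows "(\<Sum>x\<in>{0<..<3 ^ h}. bt_weight h x - 1) \<le> routing_load (mult_circulant 3 h) R"
    (is "?T \<le> ?L")
proof -
  let ?n = "3 ^ h :: int"
  let ?V = "{0..<?n}"
  have "card ?V * ?T = (\<Sum>u\<in>?V. ?T)"
    by simp
  also have "\<dots> = (\<Sum>u\<in>?V. \<Sum>v\<in>?V - {u}. bt_weight h (v - u) - 1)"
  proof (rule sum.cong[OF refl])
    fix u assume u: "u \<in> ?V"
    have "(u + x) mod ?n \<noteq> u" if "x \<in> {0<..<?n}" for x
      using translation_mod_eq_iff[of x ?n 0 u] that u by auto
    moreover have "(v - u) mod ?n > 0" if "v \<in> ?V - {u}" for v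
    proof -
      have "(v - u) mod ?n \<noteq> 0"
        using translation_mod_eq_iff[of v ?n u "-u"] that u by auto
      moreover have "(v - u) mod ?n \<ge> 0"
        by simp
      ultimately show ?thesis
        by linarith
    qed
    moreover have "bt_weight h ((u + x) mod ?n - u) = bt_weight h x" for x
      by (rule bt_weight_cong) (simp add: cong_def mod_simps)
    ultimately show "?T = (\<Sum>v\<in>?V - {u}. bt_weight h (v - u) - 1)"
      using u
      \<comment> \<open>For fixed \<open>u\<close>, targets \<open>v\<close> correspond to nonzero
        displacements \<open>x\<close> = \<open>v - u\<close> modulo \<open>3 ^ h\<close>.\<close>
      by (intro sum.reindex_bij_witness[of _ "\<lambda>v. (v - u) mod ?n" "\<lambda>x. (u + x) mod ?n"])
        (auto simp: mod_simps)
  qed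
  also have "\<dots> \<le> (\<Sum>u\<in>?V. \<Sum>v\<in>?V - {u}. length (R u v) - 2)"
  proof (intro sum_mono)
    fix u v assume "u \<in> ?V" "v \<in> ?V - {u}"
    then have "vwalk (R u v) (with_proj (mult_circulant 3 h))" "hd (R u v) = u" "last (R u v) = v"
      using assms by (auto simp: is_routing_def vpath_def)
    then show "bt_weight h (v - u) - 1 \<le> length (R u v) - 2"
      using bt_weight_le_vwalk by fastforce
  qed
  also have "\<dots> = (\<Sum>x\<in>?V. vertex_load (mult_circulant 3 h) R x)"
    using sum_vertex_load[OF _ assms] by simp
  also have "\<dots> \<le> card ?V * ?L"
    using sum_bounded_above[of ?V "vertex_load (mult_circulant 3 h) R" ?L]
    by (simp add: routing_load_def)
  finally show ?thesis
    by simp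
qed

section \<open>A routing attaining the bound\<close>

lemma ex_routing_load_le:
  "\<exists>R. is_routing (mult_circulant 3 h) R \<and>
    routing_load (mult_circulant 3 h) R \<le> (\<Sum>x\<in>{0<..<3 ^ h}. bt_weight h x - 1)"
proof -
  let ?G = "mult_circulant 3 h"
  let ?n = "3 ^ h :: int"
  let ?V = "{0..<?n}"
  obtain P where P: "\<And>x. x \<in> ?V \<Longrightarrow> vpath (P x) (with_proj ?G) \<and> hd (P x) = 0 \<and> last (P x) = x \<and>
      length (P x) = Suc (bt_weight h x)"
    using ex_vpath_bt_weight[of _ h] by metis
  then have ne: "P x \<noteq> []" if "x \<in> ?V" for x
    using that by fastforce
  \<comment> \<open>The route from \<open>u\<close> to \<open>v\<close> is the chosen path for the
    displacement \<open>v - u\<close>, translated by \<open>u\<close>.\<close>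
  define R where "R u v = map (\<lambda>x. (u + x) mod ?n) (P ((v - u) mod ?n))" for u v
  have "is_routing ?G R"
    unfolding is_routing_def
  proof (intro ballI impI)
    fix u v assume uv: "u \<in> pverts ?G" "v \<in> pverts ?G"
    let ?x = "(v - u) mod ?n"
    have x: "?x \<in> ?V"
      by simp
    have "vpath (R u v) (with_proj ?G)"
      using vpath_mult_circulant_translate[of "P ?x" 3 h u] P[OF x] by (simp add: R_def)
    moreover have "hd (R u v) = u" "last (R u v) = v"
      using P[OF x] ne[OF x] uv by (simp_all add: R_def hd_map last_map mod_simps)
    ultimately show "vpath (R u v) (with_proj ?G) \<and> hd (R u v) = u \<and> last (R u v) = v"
      by blast
  qed
  moreover have "vertex_load ?G R z \<le> (\<Sum>x\<in>{0<..<?n}. bt_weight h x - 1)" if z: "z \<in> ?V" for z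
  proof -
    let ?S = "Sigma {0<..<?n} (\<lambda>x. set (P x) - {0, x})"
    \<comment> \<open>If the route of (\<open>u\<close>, \<open>v\<close>) passes through
      \<open>z\<close> as the translate of an inner vertex \<open>y\<close> of \<open>P x\<close>,
      then \<open>u\<close> = \<open>z - y\<close> and \<open>v\<close> = \<open>u + x\<close>. So
      (\<open>x\<close>, \<open>y\<close>) determines the pair, and the load of \<open>z\<close> is
      at most the number of inner vertices of all the \<open>P x\<close>.\<close>
    let ?f = "\<lambda>(x, y). ((z - y) mod ?n, (z - y + x) mod ?n)"
    have "{(u, v). u \<in> pverts ?G \<and> v \<in> pverts ?G \<and> u \<noteq> v \<and> z \<in> set (R u v) - {u, v}} \<subseteq> ?f ` ?S"
    proof
      fix e assume "e \<in> {(u, v). u \<in> pverts ?G \<and> v \<in> pverts ?G \<and> u \<noteq> v \<and> z \<in> set (R u v) - {u, v}}"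
      then obtain u v where e: "e = (u, v)" and uv: "u \<in> pverts ?G" "v \<in> pverts ?G" "u \<noteq> v"
        "z \<in> set (R u v)" "z \<notin> {u, v}"
        by blast
      define x where "x = (v - u) mod ?n"
      obtain y where y: "y \<in> set (P x)" "z = (u + y) mod ?n"
        using uv(4) by (auto simp: R_def x_def)
      have xV: "x \<in> ?V"
        by (simp add: x_def)
      have v: "v = (u + x) mod ?n"
        using uv(2) by (simp add: x_def mod_simps)
      \<comment> \<open>These come from \<open>u\<close> \<noteq> \<open>v\<close>, \<open>z\<close>
        \<noteq> \<open>u\<close> and \<open>z\<close> \<noteq> \<open>v\<close>, in this
        order.\<close>
      have "x \<noteq> 0" "y \<noteq> 0" "y \<noteq> x"
        using uv v y(2) by auto
      then have S: "(x, y) \<in> ?S"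
        using xV y(1) by auto
      have f: "?f (x, y) = (u, v)"
      proof -
        have "(z - y + x) mod ?n = (u + y - y + x) mod ?n"
          unfolding y(2) by (metis mod_add_left_eq mod_diff_left_eq)
        then show ?thesis
          using uv(1) v y(2) by (simp add: mod_simps)
      qed
      show "e \<in> ?f ` ?S"
        unfolding e by (rule image_eqI[where x = "(x, y)"]) (rule f[symmetric], rule S)
    qed
    then have "vertex_load ?G R z \<le> card ?S"
      unfolding vertex_load_def by (rule surj_card_le[rotated]) auto
    also have "\<dots> = (\<Sum>x\<in>{0<..<?n}. card (set (P x) - {0, x}))"
      by (simp add: card_SigmaI)
    also have "\<dots> = (\<Sum>x\<in>{0<..<?n}. bt_weight h x - 1)"
    proof (intro sum.cong refl)
      fix x assume "x \<in> {0<..<?n}"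
      then have "x \<in> ?V" "0 \<noteq> x"
        by auto
      then show "card (set (P x) - {0, x}) = bt_weight h x - 1"
        using P[of x] ne[of x] card_inner_vpath[of "P x" 0 x] by (simp add: vpath_def)
    qed
    finally show ?thesis .
  qed
  then have "routing_load ?G R \<le> (\<Sum>x\<in>{0<..<?n}. bt_weight h x - 1)"
    unfolding routing_load_def by (intro Max.boundedI) auto
  ultimately show ?thesis
    by blast
qed

theorem theorem3p30:
  fixes h :: nat
  assumes "h > 0"
  shows "int (vertex_forwarding_index (mult_circulant 3 h)) = 3 ^ (h - 1) * (2 * int h - 3) + 1"
proof -
  obtain R where R: "is_routing (mult_circulant 3 h) R"
    "routing_load (mult_circulant 3 h) R = vertex_forwarding_index (mult_circulant 3 h)"
    "\<And>R'. is_routing (mult_circulant 3 h) R' \<Longrightarrow>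
      routing_load (mult_circulant 3 h) R \<le> routing_load (mult_circulant 3 h) R'"
    using vertex_forwarding_index_attained[of 3 h] assms by auto
  have "vertex_forwarding_index (mult_circulant 3 h) = (\<Sum>x\<in>{0<..<3 ^ h}. bt_weight h x - 1)"
    using routing_load_lower_bound[OF R(1)] ex_routing_load_le[of h] R(2,3)
    by (metis order.trans order_antisym)
  then show ?thesis
    using sum_bt_weight_minus_one[OF assms] by simp
qed

end
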